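(* Let $\mathcal{X}$ be an $N$-dimensional partially observable tensor with mode lengths $I_1,\ldots,I_N$ and set $\Omega$ of indices of observable entries. The computational complexity (number of elementary operations) of the serial SALS algorithm (described in the context) with rank $K$, block size $C$ ($1\le C\le K$), $T_{out}$ outer iterations and $T_{in}$ inner iterations is $$O\Bigl(T_{out}\,|\Omega|\,N\,T_{in}\,K(N+C)+T_{out}\,T_{in}\,K\,C^{2}\sum_{n=1}^{N}I_n\Bigr).$$
   Context: The serial algorithm SALS (Subset Alternating Least Square) takes as input the observable entries $x_{i_1\ldots i_N}$, $(i_1,\ldots,i_N)\in\Omega$, of $\mathcal{X}\in\mathbb{R}^{I_1\times\cdots\times I_N}$, a rank $K$ and a regularization parameter $\lambda>0$, and outputs factor matrices $\mathbf{A}^{(n)}=(a^{(n)}_{i_n k})\in\mathbb{R}^{I_n\times K}$, $1\le n\le N$. It aims to minimize $\sum_{(i_1,\ldots,i_N)\in\Omega}\bigl(x_{i_1\ldots i_N}-\sum_{k=1}^{K}\prod_{n=1}^{N}a^{(n)}_{i_n k}\bigr)^2+\lambda\sum_{n=1}^{N}\|\mathbf{A}^{(n)}\|_F^2$. Tensors $\mathcal{R}$ and $\hat{\mathcal{R}}$ below are stored only at the indices in $\Omega$, and $\Omega^{(n)}_{i_n}$ denotes the subset of $\Omega$ whose $n$th mode's index equals $i_n$. Initialization: set all entries of $\mathbf{A}^{(1)}$ to $0$, those of the other factor matrices to random values, and $\mathcal{R}=\mathcal{X}$ (so that $r_{i_1\ldots i_N}=x_{i_1\ldots i_N}-\sum_{k}\prod_{n}a^{(n)}_{i_n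 k}$). Repeat $T_{out}$ times (outer iteration): repeat $\lceil K/C\rceil$ times the following steps (a)-(d). (a) Choose $C$ columns $k_1,\ldots,k_C$ among those not yet updated in the current outer iteration (the last block contains the remaining columns, if fewer than $C$). (b) Compute $\hat r_{i_1\ldots i_N}=r_{i_1\ldots i_N}+\sum_{c=1}^{C}\prod_{n=1}^{N}a^{(n)}_{i_n k_c}$ for all $(i_1,\ldots,i_N)\in\Omega$. (c) Repeat $T_{in}$ times (inner iteration): for $n=1,\ldots,N$ and for $i_n=1,\ldots,I_n$, update $$[a^{(n)}_{i_n k_1},\ldots,a^{(n)}_{i_n k_C}]^T\leftarrow(\mathbf{B}^{(n)}_{i_n}+\lambda\mathbf{I}_C)^{-1}\mathbf{c}^{(n)}_{i_n},$$ where $\mathbf{I}_C$ is the $C\times C$ identity, $\mathbf{B}^{(n)}_{i_n}\in\mathbb{R}^{C\times C}$ has $(c_1,c_2)$th entry $\sum_{(i_1,\ldots,i_N)\in\Omega^{(n)}_{i_n}}\prod_{l\ne n}a^{(l)}_{i_l k_{c_1}}\prod_{l\ne n}a^{(l)}_{i_l k_{c_2}}$, and $\mathbf{c}^{(n)}_{i_n}\in\mathbb{R}^C$ has $c$th entry $\sum_{(i_1,\ldots,i_N)\in\Omega^{(n)}_{i_n}}\hat r_{i_1\ldots i_N}\prod_{l\ne n}a^{(l)}_{i_l k_c}$. (d) Update $r_{i_1\ldots i_N}\leftarrow\hat r_{i_1\ldots i_N}-\sum_{c=1}^{C}\prod_{n=1}^{N}a^{(n)}_{i_n k_c}$ for all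 $(i_1,\ldots,i_N)\in\Omega$. Cost convention: each real arithmetic operation costs $O(1)$, and inverting a $C\times C$ matrix costs $O(C^3)$. *)

theory Defs
  imports
    Complex_Main
    "HOL-Library.FuncSet"
    "HOL-Library.Monad_Syntax"
    "HOL-Library.Landau_Symbols"
    "Jordan_Normal_Form.Gauss_Jordan_Elimination"
begin

section \<open>Computations that count their elementary operations\<close>

text \<open>
  A computation carries its result together with the number of operations spent. All real
  arithmetic of the algorithm goes through the priced primitives below. Each addition, subtraction
  and multiplication costs 1; so does each write of a real number into an array, an entry of a
  vector or matrix, or a factor matrix. Reading stored entries, comparing or enumerating indices,
  and loop control are free.
\<close>

datatype 'a costed = Costed (result: 'a) (cost: nat)

definition pure :: "'a \<Rightarrow> 'a costed" where
  "pure x = Costed x 0"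

definition bind_costed :: "'a costed \<Rightarrow> ('a \<Rightarrow> 'b costed) \<Rightarrow> 'b costed" where
  "bind_costed m f = Costed (result (f (result m))) (cost m + cost (f (result m)))"

adhoc_overloading Monad_Syntax.bind \<rightleftharpoons> bind_costed

definition radd :: "real \<Rightarrow> real \<Rightarrow> real costed" where
  "radd x y = Costed (x + y) 1"

definition rsub :: "real \<Rightarrow> real \<Rightarrow> real costed" where
  "rsub x y = Costed (x - y) 1"

definition rmul :: "real \<Rightarrow> real \<Rightarrow> real costed" where
  "rmul x y = Costed (x * y) 1"

text \<open>
  Sums and products over a finite index set: the cost of computing every term, plus one operation
  per term for accumulating it (starting from 0 or 1).
\<close>

definition rsum :: "'i set \<Rightarrow> ('i \<Rightarrow> real costed) \<Rightarrow> real costed" where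
  "rsum S f = Costed (\<Sum>i\<in>S. result (f i)) (\<Sum>i\<in>S. (cost (f i) + 1))"

definition rprod :: "'i set \<Rightarrow> ('i \<Rightarrow> real costed) \<Rightarrow> real costed" where
  "rprod S f = Costed (\<Prod>i\<in>S. result (f i)) (\<Sum>i\<in>S. (cost (f i) + 1))"

text \<open>
  Tabulating a function: every entry is computed once and written once, and can be read for free
  afterwards. Entries of an array outside its index set are not meaningful and are set to 0.
\<close>

definition make_array :: "'i set \<Rightarrow> ('i \<Rightarrow> real costed) \<Rightarrow> ('i \<Rightarrow> real) costed" where
  "make_array S f = Costed (\<lambda>i. if i \<in> S then result (f i) else 0) (\<Sum>i\<in>S. (cost (f i) + 1))"

definition make_vec :: "nat \<Rightarrow> (nat \<Rightarrow> real costed) \<Rightarrow> real vec costed" where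
  "make_vec m f = Costed (vec m (\<lambda>c. result (f c))) (\<Sum>c<m. (cost (f c) + 1))"

definition make_mat :: "nat \<Rightarrow> (nat \<Rightarrow> nat \<Rightarrow> real costed) \<Rightarrow> real mat costed" where
  "make_mat m f = Costed (mat m m (\<lambda>(c, d). result (f c d))) (\<Sum>c<m. \<Sum>d<m. (cost (f c d) + 1))"

text \<open>\<open>\<kappa> m\<close> is the cost of inverting an \<open>m \<times> m\<close> matrix.\<close>

definition invert :: "(nat \<Rightarrow> nat) \<Rightarrow> real mat \<Rightarrow> real mat costed" where
  "invert \<kappa> M = Costed (the (mat_inverse M)) (\<kappa> (dim_row M))"

definition matrix_vector :: "nat \<Rightarrow> real mat \<Rightarrow> real vec \<Rightarrow> real vec costed" where
  "matrix_vector m M v = make_vec m (\<lambda>c. rsum {..<m} (\<lambda>d. rmul (M $$ (c, d)) (v $ d)))"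

fun for_each :: "'i list \<Rightarrow> ('i \<Rightarrow> 's \<Rightarrow> 's costed) \<Rightarrow> 's \<Rightarrow> 's costed" where
  "for_each [] body s = pure s"
| "for_each (i # xs) body s = do { s' \<leftarrow> body i s; for_each xs body s' }"


section \<open>The serial SALS algorithm\<close>

text \<open>
  Modes are numbered \<open>1..N\<close>, the indices of mode \<open>n\<close> are \<open>1..I n\<close> and the columns of the factor
  matrices are \<open>1..K\<close>. A multi-index maps each mode to its index. \<open>A n i k\<close> is the entry in row
  \<open>i\<close> and column \<open>k\<close> of the \<open>n\<close>-th factor matrix.
\<close>

type_synonym multi_index = "nat \<Rightarrow> nat"
type_synonym tensor = "multi_index \<Rightarrow> real"
type_synonym factors = "nat \<Rightarrow> nat \<Rightarrow> nat \<Rightarrow> real"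

definition multi_indices :: "nat \<Rightarrow> (nat \<Rightarrow> nat) \<Rightarrow> multi_index set" where
  "multi_indices N I = (\<Pi>\<^sub>E n\<in>{1..N}. {1..I n})"

definition slice :: "multi_index set \<Rightarrow> nat \<Rightarrow> nat \<Rightarrow> multi_index set" where
  "slice \<Omega> n i = {j \<in> \<Omega>. j n = i}"

definition write_entry :: "nat \<Rightarrow> nat \<Rightarrow> nat \<Rightarrow> real \<Rightarrow> factors \<Rightarrow> factors costed" where
  "write_entry n i k x A = Costed (A(n := (A n)(i := (A n i)(k := x)))) 1"

text \<open>The random initial values enter as an arbitrary \<open>rnd\<close>; each draw is charged as its write.\<close>

definition init_factors :: "nat \<Rightarrow> (nat \<Rightarrow> nat) \<Rightarrow> nat \<Rightarrow> factors \<Rightarrow> factors costed" where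
  "init_factors N I K rnd =
     for_each [1..<N + 1] (\<lambda>n. for_each [1..<I n + 1] (\<lambda>i. for_each [1..<K + 1] (\<lambda>k.
       write_entry n i k (if n = 1 then 0 else rnd n i k)))) (\<lambda>n i k. 0)"

text \<open>
  In the following, \<open>ks\<close> is the list of columns of the current block, and \<open>ks ! c\<close> for
  \<open>c < length ks\<close> are its columns.
\<close>

definition block_sum :: "nat \<Rightarrow> nat list \<Rightarrow> factors \<Rightarrow> multi_index \<Rightarrow> real costed" where
  "block_sum N ks A j =
     rsum {..<length ks} (\<lambda>c. rprod {1..N} (\<lambda>n. pure (A n (j n) (ks ! c))))"

text \<open>
  The products over the modes other than \<open>n\<close>, which occur in all entries of the normal equations
  of a row, are computed once per observed entry and column (array \<open>p\<close>).
\<close>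

definition update_row ::
  "(nat \<Rightarrow> nat) \<Rightarrow> nat \<Rightarrow> multi_index set \<Rightarrow> real \<Rightarrow> tensor \<Rightarrow> nat list \<Rightarrow> nat \<Rightarrow> nat \<Rightarrow> factors
     \<Rightarrow> factors costed" where
  "update_row \<kappa> N \<Omega> lam Rh ks n i A = (let m = length ks; S = slice \<Omega> n i in
     do {
       p \<leftarrow> make_array (S \<times> {..<m}) (\<lambda>(j, c).
              rprod ({1..N} - {n}) (\<lambda>l. pure (A l (j l) (ks ! c))));
       B \<leftarrow> make_mat m (\<lambda>c d. rsum S (\<lambda>j. rmul (p (j, c)) (p (j, d))));
       M \<leftarrow> make_mat m (\<lambda>c d. if c = d then radd (B $$ (c, d)) lam else pure (B $$ (c, d)));
       b \<leftarrow> make_vec m (\<lambda>c. rsum S (\<lambda>j. rmul (Rh j) (p (j, c))));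
       Minv \<leftarrow> invert \<kappa> M;
       x \<leftarrow> matrix_vector m Minv b;
       for_each [0..<m] (\<lambda>c. write_entry n i (ks ! c) (x $ c)) A
     })"

definition update_block ::
  "(nat \<Rightarrow> nat) \<Rightarrow> nat \<Rightarrow> (nat \<Rightarrow> nat) \<Rightarrow> multi_index set \<Rightarrow> real \<Rightarrow> nat \<Rightarrow> nat list
     \<Rightarrow> factors \<times> tensor \<Rightarrow> (factors \<times> tensor) costed" where
  "update_block \<kappa> N I \<Omega> lam Tin ks = (\<lambda>(A, R).
     do {
       Rh \<leftarrow> make_array \<Omega> (\<lambda>j. do { s \<leftarrow> block_sum N ks A j; radd (R j) s });
       A' \<leftarrow> for_each [0..<Tin] (\<lambda>_. for_each [1..<N + 1] (\<lambda>n. for_each [1..<I n + 1] (\<lambda>i.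
               update_row \<kappa> N \<Omega> lam Rh ks n i))) A;
       R' \<leftarrow> make_array \<Omega> (\<lambda>j. do { s \<leftarrow> block_sum N ks A' j; rsub (Rh j) s });
       pure (A', R')
     })"

definition num_blocks :: "nat \<Rightarrow> nat \<Rightarrow> nat" where
  "num_blocks K C = nat \<lceil>real K / real C\<rceil>"

text \<open>
  The choice of columns is left open: \<open>blk t b\<close> lists the columns of block \<open>b\<close> in outer iteration
  \<open>t\<close>. In every block, \<open>C\<close> columns not yet updated in this outer iteration are chosen, or all the
  remaining ones if there are fewer than \<open>C\<close>.
\<close>

definition admissible_choice :: "nat \<Rightarrow> nat \<Rightarrow> nat \<Rightarrow> (nat \<Rightarrow> nat \<Rightarrow> nat list) \<Rightarrow> bool" where
  "admissible_choice K C Tout blk \<longleftrightarrow>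
     (\<forall>t<Tout. \<forall>b<num_blocks K C.
        let remaining = {1..K} - (\<Union>b'<b. set (blk t b')) in
          distinct (blk t b) \<and> set (blk t b) \<subseteq> remaining \<and>
          length (blk t b) = min C (card remaining))"

definition sals ::
  "(nat \<Rightarrow> nat) \<Rightarrow> nat \<Rightarrow> (nat \<Rightarrow> nat) \<Rightarrow> multi_index set \<Rightarrow> tensor \<Rightarrow> nat \<Rightarrow> nat \<Rightarrow> real
     \<Rightarrow> nat \<Rightarrow> nat \<Rightarrow> factors \<Rightarrow> (nat \<Rightarrow> nat \<Rightarrow> nat list) \<Rightarrow> factors costed" where
  "sals \<kappa> N I \<Omega> X K C lam Tout Tin rnd blk =
     do {
       A \<leftarrow> init_factors N I K rnd;
       R \<leftarrow> make_array \<Omega> (\<lambda>j. pure (X j));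
       (A', R') \<leftarrow> for_each [0..<Tout] (\<lambda>t. for_each [0..<num_blocks K C] (\<lambda>b.
                    update_block \<kappa> N I \<Omega> lam Tin (blk t b))) (A, R);
       pure A'
     }"

end

theory Submission
  imports Defs
begin

text \<open>
  A row update on a slice with \<open>s\<close> observed entries costs \<open>O(s C (N + C) + C^3)\<close>. For a fixed mode
  the slices partition \<open>\<Omega>\<close>, so one sweep over all rows of all modes costs
  \<open>O(N |\<Omega>| C (N + C) + C^3 (\<Sum>n. I n))\<close>, which dominates the two residual updates of a block. There are
  at most \<open>2 K / C\<close> blocks per outer iteration.
\<close>

section \<open>Exact costs of the primitives\<close>

lemma result_pure [simp]: "result (pure x) = x" and cost_pure [simp]: "cost (pure x) = 0"
  by (simp_all add: pure_def)

lemma cost_bind [simp]: "cost (bind_costed m f) = cost m + cost (f (result m))"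
  by (simp add: bind_costed_def)

lemma cost_arith [simp]:
  "cost (radd x y) = 1" "cost (rsub x y) = 1" "cost (rmul x y) = 1"
  by (simp_all add: radd_def rsub_def rmul_def)

lemma cost_write_entry [simp]: "cost (write_entry n i k x A) = 1"
  by (simp add: write_entry_def)

lemma cost_rsum [simp]: "cost (rsum S f) = (\<Sum>i\<in>S. cost (f i) + 1)"
  and cost_rprod [simp]: "cost (rprod S f) = (\<Sum>i\<in>S. cost (f i) + 1)"
  by (simp_all add: rsum_def rprod_def)

lemma cost_make_array [simp]: "cost (make_array S f) = (\<Sum>i\<in>S. cost (f i) + 1)"
  and cost_make_vec [simp]: "cost (make_vec m g) = (\<Sum>c<m. cost (g c) + 1)"
  and cost_make_mat [simp]: "cost (make_mat m h) = (\<Sum>c<m. \<Sum>d<m. cost (h c d) + 1)"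
  by (simp_all add: make_array_def make_vec_def make_mat_def)

lemma cost_invert_make_mat [simp]: "cost (invert \<kappa> (result (make_mat m h))) = \<kappa> m"
  by (simp add: invert_def make_mat_def)

lemma cost_matrix_vector [simp]: "cost (matrix_vector m M v) = m * (2 * m + 1)"
  by (simp add: matrix_vector_def)

section \<open>Loops\<close>

text \<open>The bound \<open>f i\<close> is uniform in the state \<open>s\<close>, so the values
  produced by earlier iterations never have to be tracked. Distinctness turns the sum along the list
  into a sum over its set.\<close>

lemma cost_for_each_le:
  assumes "\<And>i s. i \<in> set xs \<Longrightarrow> cost (body i s) \<le> f i" "distinct xs"
  shows "cost (for_each xs body s) \<le> (\<Sum>i\<in>set xs. f i)"
  using assms
proof (induction xs arbitrary: s)
  case (Cons i xs)
  have "cost (for_each xs body (result (body i s))) \<le> (\<Sum>i\<in>set xs. f i)"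
    using Cons by simp
  with Cons.prems show ?case
    by (simp add: add_mono)
qed simp

lemma cost_for_each_from_one_le:
  assumes "\<And>i s. 1 \<le> i \<Longrightarrow> i \<le> n \<Longrightarrow> cost (body i s) \<le> f i"
  shows "cost (for_each [1..<n + 1] body s) \<le> (\<Sum>i=1..n. f i)"
  using cost_for_each_le[of "[1..<n + 1]" body f s] assms
  by (simp add: atLeastLessThanSuc_atLeastAtMost del: upt_Suc)

lemma cost_for_each_const_le:
  assumes "\<And>i s. i < n \<Longrightarrow> cost (body i s) \<le> d"
  shows "cost (for_each [0..<n] body s) \<le> n * d"
  using cost_for_each_le[of "[0..<n]" body "\<lambda>_. d" s] assms by simp

section \<open>Slices of the observed entries, and initialization\<close>

lemma finite_multi_indices: "finite (multi_indices N I)"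
  unfolding multi_indices_def by (intro finite_PiE) auto

text \<open>Slices of one mode are pairwise disjoint subsets of \<open>\<Omega>\<close>. This keeps
  a factor \<open>I n\<close> away from \<open>card \<Omega>\<close> when row costs are
  summed.\<close>

lemma sum_card_slice_le:
  assumes "finite \<Omega>"
  shows "(\<Sum>i=1..m. card (slice \<Omega> n i)) \<le> card \<Omega>"
proof -
  have "(\<Sum>i=1..m. card (slice \<Omega> n i)) = card (\<Union>i\<in>{1..m}. slice \<Omega> n i)"
    using assms by (subst card_UN_disjoint) (auto simp: slice_def)
  also have "\<dots> \<le> card \<Omega>"
    using assms by (intro card_mono) (auto simp: slice_def)
  finally show ?thesis .
qed

lemma cost_init_factors_le: "cost (init_factors N I K rnd) \<le> K * (\<Sum>n=1..N. I n)"
proof -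
  have "cost (for_each [1..<K + 1] (\<lambda>k. write_entry n i k (g k)) A) \<le> K" for n i g A
    using cost_for_each_from_one_le[of K "\<lambda>k. write_entry n i k (g k)" "\<lambda>_. 1" A]
    by (simp del: upt_Suc)
  then have "cost (for_each [1..<I n + 1] (\<lambda>i. for_each [1..<K + 1]
      (\<lambda>k. write_entry n i k (g i k))) A) \<le> (\<Sum>i=1..I n. K)" for n g A
    by (rule cost_for_each_from_one_le)
  then have "cost (init_factors N I K rnd) \<le> (\<Sum>n=1..N. \<Sum>i=1..I n. K)"
    unfolding init_factors_def by (rule cost_for_each_from_one_le)
  then show ?thesis
    by (simp add: sum_distrib_left mult.commute)
qed

section \<open>Rows, sweeps and blocks\<close>

text \<open>Tabulating the products makes the modes contribute \<open>s * m * N\<close> rather than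
  a multiple of \<open>s * m ^ 2 * N\<close>; the matrix \<open>B\<close> then needs only
  \<open>O(s * m ^ 2)\<close>. All work independent of the slice is at most cubic.\<close>

lemma cost_update_row_le:
  assumes "finite \<Omega>" "1 \<le> n" "n \<le> N" and "ks \<noteq> []" "length ks \<le> C"
    and \<kappa>: "\<kappa> (length ks) \<le> d * length ks ^ 3"
  shows "cost (update_row \<kappa> N \<Omega> lam Rh ks n i A)
           \<le> card (slice \<Omega> n i) * (C * (N + 4 * C)) + (8 + d) * C ^ 3"
proof -
  define m where "m = length ks"
  define s where "s = card (slice \<Omega> n i)"
  have m: "1 \<le> m" "m \<le> C"
    using assms(4,5) by (simp_all add: m_def Suc_le_eq)
  have fin: "finite (slice \<Omega> n i)"
    using assms(1) by (simp add: slice_def)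
  \<comment> \<open>Each tabulated product takes \<open>N - 1\<close> multiplications and one write,
    hence exactly \<open>N\<close> operations.\<close>
  have modes: "card ({1..N} - {n}) + 1 = N"
    using assms(2,3) by simp
  have products: "cost (make_array (slice \<Omega> n i \<times> {..<m}) (\<lambda>(j, c).
      rprod ({1..N} - {n}) (\<lambda>l. pure (A l (j l) (ks ! c))))) = s * m * N"
    using modes by (simp add: case_prod_beta s_def card_cartesian_product)
  have shift: "cost (make_mat m (\<lambda>c d. if c = d then radd (B $$ (c, d)) lam
      else pure (B $$ (c, d)))) \<le> 2 * m ^ 2" for B
  proof -
    have "cost (make_mat m (\<lambda>c d. if c = d then radd (B $$ (c, d)) lam
        else pure (B $$ (c, d)))) \<le> (\<Sum>c<m. \<Sum>d<m. 2)"
      unfolding cost_make_mat by (intro sum_mono) simp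
    then show ?thesis by (simp add: power2_eq_square)
  qed
  have row_write: "cost (for_each [0..<m] (\<lambda>c. write_entry n i (ks ! c) (x $ c)) A) \<le> m" for x
    using cost_for_each_const_le[of m "\<lambda>c. write_entry n i (ks ! c) (x $ c)" 1 A] by simp
  \<comment> \<open>The summands follow the order of execution: \<open>p\<close>, \<open>B\<close>,
    \<open>M\<close>, \<open>b\<close>, the inversion, the matrix-vector product, the
    write-back.\<close>
  have "cost (update_row \<kappa> N \<Omega> lam Rh ks n i A)
      \<le> s * m * N + (m * m * (2 * s + 1) + (2 * m ^ 2
        + (m * (2 * s + 1) + (\<kappa> m + (m * (2 * m + 1) + m)))))"
    unfolding update_row_def Let_def m_def[symmetric] cost_bind products cost_invert_make_mat
      cost_matrix_vector
    by (intro add_mono order.refl shift row_write) (simp_all add: s_def algebra_simps)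
  also have "\<dots> = s * (m * N + 2 * m ^ 2 + 2 * m) + 5 * m ^ 2 + 3 * m + \<kappa> m"
    by (simp add: algebra_simps power2_eq_square)
  \<comment> \<open>Since \<open>m\<close> is at least 1, lower powers of \<open>m\<close> are
    raised to the dominant one; this gives \<open>4 = 2 + 2\<close> and
    \<open>8 = 5 + 3\<close>.\<close>
  also have "\<dots> \<le> s * (m * N + 2 * m ^ 2 + 2 * m ^ 2) + 5 * m ^ 3 + 3 * m ^ 3 + d * m ^ 3"
    using \<kappa> m by (intro add_mono mult_le_mono order.refl)
      (auto simp: m_def self_le_power power_increasing)
  also have "\<dots> = s * (m * (N + 4 * m)) + (8 + d) * m ^ 3"
    by (simp add: algebra_simps power2_eq_square)
  also have "\<dots> \<le> s * (C * (N + 4 * C)) + (8 + d) * C ^ 3"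
    using m by (intro add_mono mult_le_mono order.refl power_mono) auto
  finally show ?thesis by (simp add: s_def)
qed

lemma cost_sweep_le:
  assumes "finite \<Omega>" and "ks \<noteq> []" "length ks \<le> C"
    and "\<kappa> (length ks) \<le> d * length ks ^ 3"
  shows "cost (for_each [1..<N + 1] (\<lambda>n. for_each [1..<I n + 1] (\<lambda>i.
             update_row \<kappa> N \<Omega> lam Rh ks n i)) A)
           \<le> N * (card \<Omega> * (C * (N + 4 * C))) + (8 + d) * C ^ 3 * (\<Sum>n=1..N. I n)"
proof -
  have "cost (for_each [1..<I n + 1] (\<lambda>i. update_row \<kappa> N \<Omega> lam Rh ks n i) A)
      \<le> card \<Omega> * (C * (N + 4 * C)) + (8 + d) * C ^ 3 * I n" if "1 \<le> n" "n \<le> N" for n A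
  proof -
    have "cost (for_each [1..<I n + 1] (\<lambda>i. update_row \<kappa> N \<Omega> lam Rh ks n i) A)
        \<le> (\<Sum>i=1..I n. card (slice \<Omega> n i) * (C * (N + 4 * C)) + (8 + d) * C ^ 3)"
      using assms that by (intro cost_for_each_from_one_le cost_update_row_le)
    also have "\<dots> = (\<Sum>i=1..I n. card (slice \<Omega> n i)) * (C * (N + 4 * C)) + (8 + d) * C ^ 3 * I n"
      by (simp only: sum.distrib sum_distrib_right) simp
    also have "\<dots> \<le> card \<Omega> * (C * (N + 4 * C)) + (8 + d) * C ^ 3 * I n"
      using assms(1) by (intro add_mono mult_le_mono order.refl sum_card_slice_le)
    finally show ?thesis .
  qed
  then have "cost (for_each [1..<N + 1] (\<lambda>n. for_each [1..<I n + 1] (\<lambda>i.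
        update_row \<kappa> N \<Omega> lam Rh ks n i)) A)
      \<le> (\<Sum>n=1..N. card \<Omega> * (C * (N + 4 * C)) + (8 + d) * C ^ 3 * I n)"
    by (intro cost_for_each_from_one_le)
  then show ?thesis
    by (simp only: sum.distrib sum_distrib_left) simp
qed

text \<open>A factor \<open>C\<close> is pulled out in front so that it can later be multiplied with
  the number of blocks; this turns \<open>C ^ 3\<close> into \<open>C ^ 2\<close>.\<close>

lemma cost_update_block_le:
  assumes "finite \<Omega>" "1 \<le> N" "1 \<le> Tin" and "ks \<noteq> []" "length ks \<le> C"
    and "\<kappa> (length ks) \<le> d * length ks ^ 3"
  shows "cost (update_block \<kappa> N I \<Omega> lam Tin ks AR)
           \<le> C * ((9 + d) * (Tin * (N * card \<Omega> * (N + C) + C ^ 2 * (\<Sum>n=1..N. I n))))"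
proof -
  obtain A R where AR: "AR = (A, R)" by (cases AR)
  define w where "w = card \<Omega>"
  define J where "J = (\<Sum>n=1..N. I n)"
  have C: "1 \<le> C"
    using assms(4,5) by (cases ks) auto
  \<comment> \<open>Per observed entry, each column costs \<open>N\<close> multiplications and one
    accumulation; the \<open>2\<close> is the final addition or subtraction and the write.\<close>
  have residual: "w * (length ks * (N + 1) + 2) \<le> 4 * (w * (C * N))"
  proof -
    have "length ks * (N + 1) + 2 \<le> C * (N + N) + 2 * (C * N)"
      using assms C by (intro add_mono mult_le_mono) auto
    also have "\<dots> = 4 * (C * N)" by (simp add: algebra_simps)
    finally have "w * (length ks * (N + 1) + 2) \<le> w * (4 * (C * N))"
      by (rule mult_le_mono2)
    then show ?thesis by simp
  qed
  have residual_R: "cost (make_array \<Omega> (\<lambda>j. do { s \<leftarrow> block_sum N ks A j; radd (R j) s }))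
      \<le> 4 * (w * (C * N))"
    using residual by (simp add: block_sum_def w_def)
  have residual_Rh: "cost (make_array \<Omega> (\<lambda>j. do { s \<leftarrow> block_sum N ks A' j; rsub (Rh j) s }))
      \<le> 4 * (w * (C * N))" for A' Rh
    using residual by (simp add: block_sum_def w_def)
  have "cost (update_block \<kappa> N I \<Omega> lam Tin ks AR)
      \<le> 4 * (w * (C * N)) + (Tin * (N * (w * (C * (N + 4 * C))) + (8 + d) * C ^ 3 * J)
        + (4 * (w * (C * N)) + 0))"
    unfolding update_block_def AR prod.case cost_bind cost_pure w_def J_def
    by (intro add_mono residual_R[unfolded w_def] residual_Rh[unfolded w_def]
        cost_for_each_const_le cost_sweep_le assms order.refl)
  also have "\<dots> = 8 * (w * (C * N)) + Tin * (N * (w * (C * (N + 4 * C))) + (8 + d) * C ^ 3 * J)"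
    by simp
  also have "\<dots> \<le> 8 * (Tin * (N * (w * (C * N))))
      + Tin * (N * (w * (C * (N + 4 * C))) + (8 + d) * C ^ 3 * J)"
  proof -
    \<comment> \<open>The residual updates lie outside the inner iterations and the loop over modes;
      the factors 1 are compared with \<open>Tin\<close> and \<open>N\<close>.\<close>
    have "1 * (1 * (w * (C * N))) \<le> Tin * (N * (w * (C * N)))"
      using assms by (intro mult_le_mono order.refl)
    then show ?thesis by simp
  qed
  also have "\<dots> = C * (Tin * (N * w * (9 * N + 4 * C) + (8 + d) * (C ^ 2 * J)))"
    by (simp add: algebra_simps power2_eq_square power3_eq_cube)
  \<comment> \<open>\<open>9 * N\<close> combines \<open>8 * N\<close> from the residuals with
    \<open>N\<close> from the sweep; \<open>9 + d\<close> dominates the coefficients 9, 4 and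
    \<open>8 + d\<close>.\<close>
  also have "\<dots> \<le> C * (Tin * (N * w * ((9 + d) * (N + C)) + (9 + d) * (C ^ 2 * J)))"
    by (intro mult_le_mono add_mono order.refl) (simp_all add: algebra_simps)
  also have "\<dots> = C * ((9 + d) * (Tin * (N * w * (N + C) + C ^ 2 * J)))"
    by (simp add: algebra_simps)
  finally show ?thesis by (simp add: w_def J_def)
qed

section \<open>Number and size of the blocks\<close>

text \<open>Rounding up adds at most one block, that is \<open>C\<close> columns, and
  \<open>C\<close> is at most \<open>K\<close>.\<close>

lemma num_blocks_mult_le:
  assumes "1 \<le> C" "C \<le> K"
  shows "num_blocks K C * C \<le> 2 * K"
proof -
  have "real (num_blocks K C) \<le> real K / real C + 1"
    using divide_nonneg_nonneg[of "real K" "real C"] unfolding num_blocks_def by linarith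
  then have "real (num_blocks K C) * real C \<le> (real K / real C + 1) * real C"
    by (intro mult_right_mono) auto
  also have "\<dots> = real K + real C"
    using assms by (simp add: field_simps)
  also have "\<dots> \<le> real (2 * K)"
    using assms by simp
  finally have "real (num_blocks K C * C) \<le> real (2 * K)" by simp
  then show ?thesis by (simp only: of_nat_le_iff)
qed

text \<open>Used to see that the first \<open>b\<close> blocks, of at most \<open>C\<close> columns
  each, cannot exhaust all \<open>K\<close> columns.\<close>

lemma mult_less_if_less_num_blocks:
  assumes "1 \<le> C" "b < num_blocks K C"
  shows "b * C < K"
proof -
  have "real b < real K / real C"
    using assms(2) unfolding num_blocks_def by linarith
  then have "real (b * C) < real K"
    using assms(1) by (simp add: field_simps)
  then show ?thesis by (simp only: of_nat_less_iff)
qed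

text \<open>Blocks must be shown nonempty, because nothing is known about \<open>\<kappa> 0\<close>.\<close>

lemma admissible_choice_block:
  assumes adm: "admissible_choice K C Tout blk" and "1 \<le> C" "t < Tout" "b < num_blocks K C"
  shows "blk t b \<noteq> []" "length (blk t b) \<le> C"
proof -
  have len: "length (blk t b') = min C (card ({1..K} - (\<Union>b''<b'. set (blk t b''))))"
    if "b' < num_blocks K C" for b'
    using adm assms(3) that unfolding admissible_choice_def Let_def by blast
  show "length (blk t b) \<le> C"
    using len[OF assms(4)] by simp
  \<comment> \<open>Nonemptiness: the earlier blocks cover fewer than \<open>K\<close> columns, so
    some column remains to be chosen.\<close>
  have "card (\<Union>b'<b. set (blk t b')) \<le> (\<Sum>b'<b. card (set (blk t b')))"
    by (intro card_UN_le) simp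
  also have "\<dots> \<le> (\<Sum>b'<b. C)"
  proof (intro sum_mono)
    fix b' assume "b' \<in> {..<b}"
    then have "length (blk t b') \<le> C"
      using len[of b'] assms(4) by simp
    then show "card (set (blk t b')) \<le> C"
      using card_length[of "blk t b'"] by linarith
  qed
  also have "\<dots> < K"
    using mult_less_if_less_num_blocks[OF assms(2,4)] by simp
  finally have "card (\<Union>b'<b. set (blk t b')) < card {1..K}" by simp
  then have "0 < card ({1..K} - (\<Union>b'<b. set (blk t b')))"
    using diff_card_le_card_Diff[of "\<Union>b'<b. set (blk t b')" "{1..K}"] by simp
  then show "blk t b \<noteq> []"
    using len[OF assms(4)] assms(2) by auto
qed

section \<open>Total cost and the asymptotic bound\<close>

text \<open>The constant is \<open>1 + 2 * (9 + d)\<close>: one copy of the bound absorbs the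
  initialization, and the 2 comes from \<open>num_blocks_mult_le\<close>.\<close>

lemma cost_sals_le:
  assumes \<kappa>: "\<And>m. 1 \<le> m \<Longrightarrow> \<kappa> m \<le> d * m ^ 3"
    and "1 \<le> N" "\<Omega> \<subseteq> multi_indices N I" "1 \<le> C" "C \<le> K" "1 \<le> Tout" "1 \<le> Tin"
    and adm: "admissible_choice K C Tout blk"
  shows "cost (sals \<kappa> N I \<Omega> X K C lam Tout Tin rnd blk)
           \<le> (19 + 2 * d) * (Tout * Tin * K
               * (N * card \<Omega> * (N + C) + C ^ 2 * (\<Sum>n=1..N. I n)))"
proof -
  define J where "J = (\<Sum>n=1..N. I n)"
  define E where "E = N * card \<Omega> * (N + C) + C ^ 2 * J"
  have fin: "finite \<Omega>"
    using assms(3) finite_multi_indices finite_subset by blast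
  have block: "cost (update_block \<kappa> N I \<Omega> lam Tin (blk t b) AR) \<le> C * ((9 + d) * (Tin * E))"
    if "t < Tout" "b < num_blocks K C" for t b AR
  proof -
    note ks = admissible_choice_block[OF adm assms(4) that]
    have "1 \<le> length (blk t b)"
      using ks(1) by (cases "blk t b") auto
    then show ?thesis
      unfolding E_def J_def using fin assms ks \<kappa> by (intro cost_update_block_le) auto
  qed
  have loop: "cost (for_each [0..<Tout] (\<lambda>t. for_each [0..<num_blocks K C] (\<lambda>b.
      update_block \<kappa> N I \<Omega> lam Tin (blk t b))) AR)
      \<le> Tout * (num_blocks K C * (C * ((9 + d) * (Tin * E))))" for AR
    by (intro cost_for_each_const_le block)
  have "cost (sals \<kappa> N I \<Omega> X K C lam Tout Tin rnd blk)
      \<le> K * J + (card \<Omega> + (Tout * (num_blocks K C * (C * ((9 + d) * (Tin * E)))) + 0))"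
    unfolding sals_def cost_bind J_def
    by (intro add_mono loop cost_init_factors_le) (simp_all split: prod.split)
  also have "\<dots> = (K * J + card \<Omega>) + (num_blocks K C * C) * (Tout * ((9 + d) * (Tin * E)))"
    by (simp add: algebra_simps)
  also have "\<dots> \<le> Tout * Tin * K * E + (2 * K) * (Tout * ((9 + d) * (Tin * E)))"
  proof (rule add_mono)
    \<comment> \<open>Initialization is absorbed because \<open>N * (N + C)\<close>,
      \<open>C ^ 2\<close>, \<open>K\<close>, \<open>Tout\<close> and \<open>Tin\<close> are all at
      least 1.\<close>
    have "J + card \<Omega> \<le> (N * (N + C)) * card \<Omega> + C ^ 2 * J"
    proof -
      have "1 * card \<Omega> \<le> (N * (N + C)) * card \<Omega>" "1 * J \<le> C ^ 2 * J"
        using assms by (intro mult_le_mono; simp)+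
      then show ?thesis
        unfolding mult_1 by (subst add.commute) (rule add_mono)
    qed
    then have "J + card \<Omega> \<le> E" by (simp add: E_def algebra_simps)
    moreover have "K * J + card \<Omega> \<le> K * (J + card \<Omega>)"
      using assms by (simp add: algebra_simps)
    ultimately have "K * J + card \<Omega> \<le> 1 * 1 * K * E"
      by (simp add: mult_le_mono2 order.trans)
    also have "\<dots> \<le> Tout * Tin * K * E"
      using assms by (intro mult_le_mono order.refl)
    finally show "K * J + card \<Omega> \<le> Tout * Tin * K * E" .
  next
    show "num_blocks K C * C * (Tout * ((9 + d) * (Tin * E)))
        \<le> 2 * K * (Tout * ((9 + d) * (Tin * E)))"
      using num_blocks_mult_le assms by (intro mult_le_mono1) auto
  qed
  also have "\<dots> = (19 + 2 * d) * (Tout * Tin * K * E)"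
    by (simp add: algebra_simps)
  finally show ?thesis by (simp add: E_def J_def)
qed

lemma bigo_cube_nat_bound:
  assumes "(\<lambda>m. real (f m)) \<in> O(\<lambda>m. real m ^ 3)"
  obtains d :: nat where "\<And>m. 1 \<le> m \<Longrightarrow> f m \<le> d * m ^ 3"
proof -
  obtain c where "\<forall>\<^sub>F m in sequentially. norm (real (f m)) \<le> c * norm (real m ^ 3)"
    using assms by (elim landau_o.bigE) auto
  then obtain M where M: "\<And>m. m \<ge> M \<Longrightarrow> real (f m) \<le> c * real m ^ 3"
    by (auto simp: eventually_sequentially)
  \<comment> \<open>The ceiling serves all \<open>m\<close> from \<open>M\<close> on; the sum serves
    the finitely many smaller ones, where \<open>m ^ 3\<close> is at least 1 because
    \<open>m = 0\<close> is excluded.\<close>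
  define d where "d = nat \<lceil>c\<rceil> + (\<Sum>m<M. f m)"
  show thesis
  proof
    fix m :: nat assume m: "1 \<le> m"
    show "f m \<le> d * m ^ 3"
    proof (cases "m < M")
      case True
      then have "f m \<le> d * 1"
        using member_le_sum[of m "{..<M}" f] by (simp add: d_def)
      also have "\<dots> \<le> d * m ^ 3"
        using m by (intro mult_le_mono) auto
      finally show ?thesis .
    next
      case False
      then have "real (f m) \<le> c * real m ^ 3" by (intro M) simp
      also have "\<dots> \<le> real d * real m ^ 3"
      proof (intro mult_right_mono)
        have "c \<le> real (nat \<lceil>c\<rceil>)" by (rule real_nat_ceiling_ge)
        also have "\<dots> \<le> real d" by (simp only: d_def of_nat_le_iff le_add1)
        finally show "c \<le> real d" .
      qed simp
      finally have "real (f m) \<le> real (d * m ^ 3)" by simp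
      then show ?thesis by (simp only: of_nat_le_iff)
    qed
  qed
qed

text \<open>The \<open>O\<close> is uniform: \<open>c\<close> depends only on
  \<open>\<kappa>\<close> and is fixed before the input, the random start and the column
  choices.\<close>

theorem theorem2:
  fixes \<kappa> :: "nat \<Rightarrow> nat"
  assumes inversion_cost: "(\<lambda>m. real (\<kappa> m)) \<in> O(\<lambda>m. real m ^ 3)"
  shows "\<exists>c>0. \<forall>(N::nat) (I :: nat \<Rightarrow> nat) (\<Omega> :: multi_index set) (X :: tensor) (K::nat) (C::nat)
           (lam::real) (Tout::nat) (Tin::nat) (rnd :: factors) (blk :: nat \<Rightarrow> nat \<Rightarrow> nat list).
           N \<ge> 1 \<longrightarrow> \<Omega> \<subseteq> multi_indices N I \<longrightarrow> 1 \<le> C \<longrightarrow> C \<le> K \<longrightarrow> lam > 0 \<longrightarrow>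
           Tout \<ge> 1 \<longrightarrow> Tin \<ge> 1 \<longrightarrow> admissible_choice K C Tout blk \<longrightarrow>
           real (cost (sals \<kappa> N I \<Omega> X K C lam Tout Tin rnd blk))
             \<le> c * (real Tout * real (card \<Omega>) * real N * real Tin * real K * (real N + real C)
                    + real Tout * real Tin * real K * (real C)\<^sup>2 * (\<Sum>n=1..N. real (I n)))"
proof -
  obtain d where d: "\<And>m. 1 \<le> m \<Longrightarrow> \<kappa> m \<le> d * m ^ 3"
    by (rule bigo_cube_nat_bound[OF inversion_cost]) blast
  show ?thesis
  proof (intro exI[of _ "real (19 + 2 * d)"] conjI allI impI)
    fix N :: nat and I :: "nat \<Rightarrow> nat" and \<Omega> :: "multi_index set" and X :: tensor
      and K C Tout Tin :: nat and lam :: real and rnd :: factors and blk :: "nat \<Rightarrow> nat \<Rightarrow> nat list"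
    assume "1 \<le> N" "\<Omega> \<subseteq> multi_indices N I" "1 \<le> C" "C \<le> K" "1 \<le> Tout" "1 \<le> Tin"
      "admissible_choice K C Tout blk"
    then have "real (cost (sals \<kappa> N I \<Omega> X K C lam Tout Tin rnd blk))
        \<le> real ((19 + 2 * d) * (Tout * Tin * K
            * (N * card \<Omega> * (N + C) + C ^ 2 * (\<Sum>n=1..N. I n))))"
      unfolding of_nat_le_iff by (intro cost_sals_le d)
    also have "\<dots> = real (19 + 2 * d)
        * (real Tout * real (card \<Omega>) * real N * real Tin * real K * (real N + real C)
           + real Tout * real Tin * real K * (real C)\<^sup>2 * (\<Sum>n=1..N. real (I n)))"
      unfolding of_nat_mult of_nat_add of_nat_power of_nat_sum by (simp only: algebra_simps)
    finally show "real (cost (sals \<kappa> N I \<Omega> X K C lam Tout Tin rnd blk))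
        \<le> real (19 + 2 * d)
          * (real Tout * real (card \<Omega>) * real N * real Tin * real K * (real N + real C)
             + real Tout * real Tin * real K * (real C)\<^sup>2 * (\<Sum>n=1..N. real (I n)))" .
  qed simp
qed

end
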